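(* For any integer $k \geq 2$, every $\frac{k+1}{2}$-tough $(K_2 \cup kK_1)$-free graph $G$ with $\delta(G) \geq 2k$ is Hamilton-connected.
   Context: Graphs are finite and simple. $\delta(G)$ is the minimum degree of $G$. $K_2\cup kK_1$ denotes the disjoint union of one edge $K_2$ and $k$ isolated vertices; a graph is $(K_2\cup kK_1)$-free if it contains no induced subgraph isomorphic to $K_2\cup kK_1$. For $S\subseteq V(G)$, $\omega(G-S)$ is the number of components of $G-S$. The toughness of a non-complete graph $G$ is $\tau(G)=\min\{|S|/\omega(G-S) : S\subseteq V(G),\ \omega(G-S)\ge 2\}$, and $\tau(G)=\infty$ if $G$ is complete; $G$ is $t$-tough if $\tau(G)\ge t$. A graph is Hamilton-connected if any two distinct vertices are the endpoints of a Hamilton path (a path containing every vertex). *)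

theory Defs
  imports "Graph_Theory.Graph_Theory" "HOL-Library.Extended_Real"
begin

text \<open>
  A finite simple graph is a \<^locale>\<open>pair_graph\<close>: an edge between \<open>u\<close> and \<open>v\<close> is represented by
  the two arcs \<open>(u, v)\<close> and \<open>(v, u)\<close>.
\<close>

text \<open>By symmetry, the degree of a vertex is its out-degree.\<close>

definition min_degree :: "'a pair_pre_digraph \<Rightarrow> nat" where
  "min_degree G = Min (out_degree G ` pverts G)"

text \<open>
  The components are the maximal connected subgraphs. A subgraph may in principle contain only one
  arc of an edge, but a maximal connected subgraph of a symmetric graph contains both; and
  \<^const>\<open>connected\<close> graphs are nonempty.
\<close>

definition components :: "('a, 'b) pre_digraph \<Rightarrow> ('a, 'b) pre_digraph set" where
  "components G = {H. pre_digraph.max_subgraph G connected H}"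

definition num_components_del :: "'a pair_pre_digraph \<Rightarrow> 'a set \<Rightarrow> nat" where
  "num_components_del G S = card (components (with_proj G \<restriction> (pverts G - S)))"

text \<open>
  For a finite non-complete graph the minimum ranges over a nonempty finite set:
  deleting all vertices except two non-adjacent ones leaves two components.
\<close>

definition toughness :: "'a pair_pre_digraph \<Rightarrow> ereal" where
  "toughness G =
     (if \<exists>n. K\<^bsub>n\<^esub> (with_proj G) then \<infinity>
      else Min {ereal (real (card S) / real (num_components_del G S)) | S.
                S \<subseteq> pverts G \<and> num_components_del G S \<ge> 2})"

definition tough :: "real \<Rightarrow> 'a pair_pre_digraph \<Rightarrow> bool" where
  "tough t G \<longleftrightarrow> toughness G \<ge> ereal t"

text \<open>The graph $K_2 \cup kK_1$ has the edge \<open>{0, 1}\<close> and the isolated vertices \<open>2, \<dots>, k + 1\<close>.\<close>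

definition K2_union_kK1 :: "nat \<Rightarrow> nat pair_pre_digraph" where
  "K2_union_kK1 k = \<lparr> pverts = {0..<k + 2}, parcs = {(0, 1), (1, 0)} \<rparr>"

definition induced_free :: "'b pair_pre_digraph \<Rightarrow> 'a pair_pre_digraph \<Rightarrow> bool" where
  "induced_free F G \<longleftrightarrow>
     \<not> (\<exists>H. induced_subgraph H (with_proj G) \<and> digraph_iso H (with_proj F))"

definition hamilton_path :: "'a pair_pre_digraph \<Rightarrow> 'a \<Rightarrow> ('a \<times> 'a) awalk \<Rightarrow> 'a \<Rightarrow> bool" where
  "hamilton_path G u p v \<longleftrightarrow>
     pre_digraph.apath G u p v \<and> set (pre_digraph.awalk_verts G u p) = pverts G"

definition hamilton_connected :: "'a pair_pre_digraph \<Rightarrow> bool" where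
  "hamilton_connected G \<longleftrightarrow>
     (\<forall>u \<in> pverts G. \<forall>v \<in> pverts G. u \<noteq> v \<longrightarrow> (\<exists>p. hamilton_path G u p v))"

end

theory Submission
  imports Defs
begin

text \<open>
  Let \<open>P\<close> be a longest path from \<open>u\<close> to \<open>v\<close> and suppose that it misses some vertex. Three kinds of
  information are played against each other.

  Longest paths. If a connected set of vertices off \<open>P\<close> is adjacent to \<open>x\<close> and \<open>x'\<close> on \<open>P\<close>, then the
  successors of \<open>x\<close> and \<open>x'\<close> on \<open>P\<close> are adjacent neither to that set (\<open>no_detour\<close>) nor to each other
  (\<open>no_double_detour\<close>), as otherwise \<open>P\<close> could be rerouted into a longer path.

  The forbidden subgraph. If \<open>y\<close> has a neighbour in an independent set \<open>I\<close>, that edge together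
  with the non-neighbours of \<open>y\<close> in \<open>I\<close> induces a \<open>K\<^sub>2 \<union> jK\<^sub>1\<close>; hence \<open>y\<close> misses at most \<open>k - 1\<close>
  vertices of \<open>I\<close> (\<open>card_nonneighbours_less\<close>).

  Toughness. A separating set has at least \<open>k + 1\<close> vertices, and an independent set with at
  least two vertices has more than that number of vertices outside it.

  The vertices off \<open>P\<close> are pairwise non-adjacent: the neighbours on \<open>P\<close> of the component of
  an edge off \<open>P\<close> form a separating set, so they have at least \<open>k\<close> successors, and these together
  with the edge form a forbidden subgraph (\<open>outside_edge_free\<close>). Hence a missed vertex \<open>h\<close> has all
  its \<open>2k\<close> or more neighbours on \<open>P\<close>. With the set \<open>S\<close> of their successors, which has at least \<open>2k - 1\<close>
  elements, \<open>S\<close> and the vertices off \<open>P\<close> together form an independent set. Extend it to a maximal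
  one, \<open>I\<close>. By toughness more vertices lie outside \<open>I\<close> than inside; all of these are on \<open>P\<close>, so two
  of them, \<open>y\<close> and \<open>z\<close>, are consecutive there. Each misses at most \<open>k - 1\<close> of the \<open>2k\<close> or more vertices in
  \<open>S \<union> {h}\<close>, so at least two of those are adjacent to both \<open>y\<close> and \<open>z\<close>. Neither is \<open>h\<close>, which
  could be inserted into \<open>P\<close> between \<open>y\<close> and \<open>z\<close>, so one of them is some \<open>s \<in> S\<close> with \<open>s \<noteq> v\<close>.
  Now \<open>P\<close> can be rerouted so that \<open>h\<close> replaces \<open>s\<close> and \<open>y\<close>, \<open>z\<close> stay consecutive
  (\<open>exchange_successor\<close>); inserting \<open>s\<close> between them gives a path longer than \<open>P\<close>.
\<close>

section \<open>Consecutive vertices of a list\<close>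

text \<open>
  A pair in \<open>vwalk_arcs p\<close> consists of a vertex and its successor on \<open>p\<close>. Rerouting a path means
  cutting it between such pairs and reassembling the pieces, some of them reversed; nonempty pieces
  described by their first and last vertices make this a matter of appending lists.
\<close>

lemma vwalk_arcs_nth_iff:
  "(x, s) \<in> set (vwalk_arcs p) \<longleftrightarrow> (\<exists>i. Suc i < length p \<and> p ! i = x \<and> p ! Suc i = s)"
proof (induction p rule: vwalk_arcs.induct)
  case (3 a b p)
  show ?case (is "_ \<longleftrightarrow> (\<exists>i. ?Q i)")
  proof -
    have "(\<exists>i. ?Q i) \<longleftrightarrow> ?Q 0 \<or> (\<exists>i. ?Q (Suc i))"
      by (metis not0_implies_Suc)
    then show ?thesis
      using 3 by auto
  qed
qed auto

lemma vwalk_arcs_splitE: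
  assumes "(x, s) \<in> set (vwalk_arcs p)"
  obtains A B where "p = A @ B" "A \<noteq> []" "B \<noteq> []" "last A = x" "hd B = s"
proof -
  obtain i where i: "Suc i < length p" "p ! i = x" "p ! Suc i = s"
    using assms by (auto simp: vwalk_arcs_nth_iff)
  show ?thesis
  proof (rule that)
    show "p = take (Suc i) p @ drop (Suc i) p" by simp
    show "last (take (Suc i) p) = x" using i by (simp add: take_Suc_conv_app_nth)
    show "hd (drop (Suc i) p) = s" using i by (simp add: hd_drop_conv_nth)
  qed (use i in auto)
qed

lemma vwalk_arcs_split2:
  assumes "(x, s) \<in> set (vwalk_arcs p)" "(x', s') \<in> set (vwalk_arcs p)" "x \<noteq> x'"
  shows "\<exists>A B C. p = A @ B @ C \<and> A \<noteq> [] \<and> B \<noteq> [] \<and> C \<noteq> [] \<and>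
    (last A = x \<and> hd B = s \<and> last B = x' \<and> hd C = s' \<or>
     last A = x' \<and> hd B = s' \<and> last B = x \<and> hd C = s)"
proof -
  have split: "\<exists>A B C. p = A @ B @ C \<and> A \<noteq> [] \<and> B \<noteq> [] \<and> C \<noteq> [] \<and>
      last A = p ! i \<and> hd B = p ! Suc i \<and> last B = p ! j \<and> hd C = p ! Suc j"
    if "i < j" "Suc j < length p" for i j
  proof (intro exI conjI)
    let ?A = "take (Suc i) p" and ?B = "take (j - i) (drop (Suc i) p)" and ?C = "drop (Suc j) p"
    have "Suc i + (j - i) = Suc j" using that by simp
    then show "p = ?A @ ?B @ ?C"
      by (metis append.assoc append_take_drop_id take_add)
    show "?A \<noteq> []" "?B \<noteq> []" "?C \<noteq> []" using that by auto
    show "last ?A = p ! i" using that by (simp add: take_Suc_conv_app_nth)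
    show "hd ?B = p ! Suc i" using that by (simp add: hd_conv_nth)
    show "last ?B = p ! j" using that by (auto simp: last_conv_nth min_def)
    show "hd ?C = p ! Suc j" using that by (simp add: hd_drop_conv_nth)
  qed
  obtain i j where ij: "Suc i < length p" "p ! i = x" "p ! Suc i = s"
    "Suc j < length p" "p ! j = x'" "p ! Suc j = s'"
    using assms(1,2) by (auto simp: vwalk_arcs_nth_iff)
  then consider "i < j" | "j < i" using assms(3) by (metis linorder_neqE_nat)
  then show ?thesis
  proof cases
    case 1
    from split[OF this ij(4)] show ?thesis unfolding ij by blast
  next
    case 2
    from split[OF this ij(1)] show ?thesis unfolding ij by blast
  qed
qed

lemma vwalk_arcs_in_set: "(x, y) \<in> set (vwalk_arcs p) \<Longrightarrow> x \<in> set p \<and> y \<in> set p"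
  by (auto simp: vwalk_arcs_nth_iff)

lemma ex_successor:
  assumes "s \<in> set p" "s \<noteq> last p"
  shows "\<exists>w. (s, w) \<in> set (vwalk_arcs p)"
proof -
  obtain i where i: "i < length p" "p ! i = s"
    using assms(1) by (auto simp: in_set_conv_nth)
  have "Suc i < length p"
  proof (rule ccontr)
    assume "\<not> Suc i < length p"
    then have "i = length p - 1" using i by simp
    then show False using i assms last_conv_nth[of p] by fastforce
  qed
  then show ?thesis using i by (auto simp: vwalk_arcs_nth_iff)
qed

lemma successor_unique:
  "distinct p \<Longrightarrow> (x, s) \<in> set (vwalk_arcs p) \<Longrightarrow> (x, s') \<in> set (vwalk_arcs p) \<Longrightarrow> s = s'"
  by (auto simp: vwalk_arcs_nth_iff nth_eq_iff_index_eq)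

lemma predecessor_unique:
  "distinct p \<Longrightarrow> (x, s) \<in> set (vwalk_arcs p) \<Longrightarrow> (x', s) \<in> set (vwalk_arcs p) \<Longrightarrow> x = x'"
  unfolding vwalk_arcs_nth_iff by (metis nat.inject nth_eq_iff_index_eq)

text \<open>
  Only the last vertex of \<open>p\<close> has no successor, which is the reason for subtracting one.
\<close>

lemma card_successors:
  assumes "distinct p" "X \<subseteq> set p"
  shows "card X - 1 \<le> card (set (vwalk_arcs p) `` X)" (is "_ \<le> card ?S")
proof -
  define f where "f x = (SOME w. (x, w) \<in> set (vwalk_arcs p))" for x
  have f: "(x, f x) \<in> set (vwalk_arcs p)" if "x \<in> X - {last p}" for x
    unfolding f_def by (rule someI_ex) (use ex_successor[of x p] assms(2) that in auto)
  have "inj_on f (X - {last p})"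
  proof
    fix x y assume "x \<in> X - {last p}" "y \<in> X - {last p}" "f x = f y"
    then show "x = y"
      using f[of x] f[of y] predecessor_unique[OF assms(1), of x "f x" y] by simp
  qed
  moreover have "f ` (X - {last p}) \<subseteq> ?S" using f by auto
  moreover have "finite ?S"
    by (rule finite_subset[of _ "set p"]) (auto dest: vwalk_arcs_in_set)
  ultimately have "card (X - {last p}) \<le> card ?S"
    using card_inj_on_le by blast
  moreover have "card X - 1 \<le> card (X - {last p})"
    using assms(2) finite_subset[of X "set p"] by (cases "last p \<in> X") auto
  ultimately show ?thesis by simp
qed

text \<open>
  If no two consecutive entries avoid \<open>I\<close>, then the entries outside \<open>I\<close> are separated by entries
  in \<open>I\<close>; the extra one occurs when the list both starts and ends outside \<open>I\<close>.
\<close>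

lemma alternating_list_bound:
  assumes "\<And>y z. (y, z) \<in> set (vwalk_arcs p) \<Longrightarrow> y \<in> I \<or> z \<in> I"
  shows "length (filter (\<lambda>x. x \<notin> I) p) \<le> length (filter (\<lambda>x. x \<in> I) p) + 1"
  using assms
proof (induction p rule: induct_list012)
  case (3 a b p)
  have sub: "set (vwalk_arcs p) \<subseteq> set (vwalk_arcs (b # p))" "set (vwalk_arcs (b # p)) \<subseteq> set (vwalk_arcs (a # b # p))"
    by (cases p, auto)
  have "length (filter (\<lambda>x. x \<notin> I) p) \<le> length (filter (\<lambda>x. x \<in> I) p) + 1"
    by (rule 3(1)) (use sub 3(3) in blast)
  moreover have "length (filter (\<lambda>x. x \<notin> I) (b # p)) \<le> length (filter (\<lambda>x. x \<in> I) (b # p)) + 1"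
    by (rule 3(2)) (use sub 3(3) in blast)
  moreover have "a \<in> I \<or> b \<in> I" using 3(3)[of a b] by simp
  ultimately show ?case by (auto split: if_splits)
qed auto

section \<open>Toughness and the forbidden subgraph\<close>

text \<open>
  Maximality over all subgraphs selects induced ones, since adding arcs preserves connectedness, and
  in an induced subgraph of a symmetric graph connectedness is strong connectedness. So components
  can be counted by reachability.
\<close>

lemma (in sym_digraph) components_eq_sccs: "components G = sccs"
proof -
  have mono: "arc_mono (connected :: ('a, 'b) pre_digraph \<Rightarrow> bool)"
    unfolding arc_mono_def
    by (metis spanning_def subgraphE wf_digraph.connected_spanning_imp_connected)
  have strong: "strongly_connected (G \<restriction> verts H)"
    if "subgraph H G" "connected H" for H
  proof -
    have V: "verts H \<subseteq> verts G" using that by auto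
    then have "subgraph H (G \<restriction> verts H)" "verts H = verts (G \<restriction> verts H)"
      using that subgraph_induce_subgraphI2[of H G] by auto
    with mono that have "connected (G \<restriction> verts H)"
      unfolding arc_mono_def by blast
    moreover have "symmetric (G \<restriction> verts H)"
      using induced_graph_imp_symmetric[OF sym_arcs] V by blast
    ultimately show ?thesis
      using wf_digraph.symmetric_connected_imp_strongly_connected wellformed_induce_subgraph by blast
  qed
  have weak: "connected H" if "strongly_connected H" "subgraph H G" for H
    unfolding connected_def
    using that wf_digraph.reachable_mk_symmetricI[of H]
    by (auto simp: strongly_connected_def)
  show ?thesis
  proof (intro equalityI subsetI)
    fix H assume "H \<in> components G"
    then have H: "max_subgraph connected H" by (simp add: components_def)
    then have "G \<restriction> verts H = H"
      using mono by (intro induce_eq_iff_induced induced_subgraphI_arc_mono)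
    then have "strongly_connected H"
      using strong[of H] H by (simp add: max_subgraph_def)
    then show "H \<in> sccs"
      using H weak unfolding sccs_altdef2 max_subgraph_def by blast
  next
    fix H assume "H \<in> sccs"
    then have H: "max_subgraph strongly_connected H" by (simp add: sccs_altdef2)
    have "K = H" if K: "subgraph H K" "subgraph K G" "connected K" for K
    proof -
      have KV: "verts K \<subseteq> verts G" using K by auto
      have sub: "subgraph K (G \<restriction> verts K)" "subgraph (G \<restriction> verts K) G"
        using K subgraph_induce_subgraphI2[of K G] induced_induce[OF KV] by auto
      then have "subgraph H (G \<restriction> verts K)"
        using K(1) subgraph_trans by blast
      then have eq: "G \<restriction> verts K = H"
        using H strong[OF K(2,3)] sub(2) by (metis max_subgraph_def)
      have "arcs K \<subseteq> arcs H" "arcs H \<subseteq> arcs K" "verts K = verts H" "tail K = tail H" "head K = head H"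
        using K eq sub by (auto simp: subgraph_def compatible_def)
      then show ?thesis by (intro pre_digraph.equality) auto
    qed
    then show "H \<in> components G"
      using H weak unfolding components_def max_subgraph_def by blast
  qed
qed

lemma (in sym_digraph) card_le_components:
  assumes "finite (verts G)" "W \<subseteq> verts G"
    and "\<And>x y. x \<in> W \<Longrightarrow> y \<in> W \<Longrightarrow> x \<noteq> y \<Longrightarrow> \<not> x \<rightarrow>\<^sup>*\<^bsub>G\<^esub> y"
  shows "card W \<le> card (components G)"
proof -
  have "inj_on scc_of W"
  proof
    fix x y assume "x \<in> W" "y \<in> W" "scc_of x = scc_of y"
    then have "y \<in> scc_of x" using assms(2) in_scc_of_self by auto
    then show "x = y" using assms(3) \<open>x \<in> W\<close> \<open>y \<in> W\<close> by (auto simp: scc_of_def)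
  qed
  moreover have "scc_of ` W \<subseteq> sccs_verts"
    using assms(2) scc_of_in_sccs_verts by auto
  moreover have "finite sccs_verts"
    by (rule finite_subset[of _ "Pow (verts G)"]) (use sccs_verts_subsets assms(1) in auto)
  ultimately have "card W \<le> card sccs_verts"
    using card_inj_on_le by blast
  then show ?thesis by (simp add: card_sccs_verts components_eq_sccs)
qed

definition independent_set :: "'a pair_pre_digraph \<Rightarrow> 'a set \<Rightarrow> bool" where
  "independent_set G X \<longleftrightarrow> X \<subseteq> pverts G \<and> (\<forall>x\<in>X. \<forall>y\<in>X. (x, y) \<notin> parcs G)"

context pair_graph
begin

text \<open>
  This is the form in which toughness is used: instead of the components of \<open>G - S\<close> it takes
  representatives of some of them. Two such representatives are non-adjacent, so that the graph is not
  complete and the minimum in the definition of toughness is the relevant case.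
\<close>

lemma tough_card_le:
  assumes "tough t G" "t \<ge> 0" "S \<subseteq> pverts G" "W \<subseteq> pverts G - S" "card W \<ge> 2"
    and sep: "\<And>x y. x \<in> W \<Longrightarrow> y \<in> W \<Longrightarrow> x \<noteq> y \<Longrightarrow> \<not> x \<rightarrow>\<^sup>*\<^bsub>with_proj G \<restriction> (pverts G - S)\<^esub> y"
  shows "t * real (card W) \<le> real (card S)"
proof -
  let ?D = "with_proj G \<restriction> (pverts G - S)"
  let ?c = "num_components_del G S"
  interpret D: sym_digraph ?D
    by (rule induced_graph_imp_graph) (auto intro!: induced_induce)
  have W: "card W \<le> ?c"
    unfolding num_components_del_def
    by (rule D.card_le_components) (use assms in auto)
  have "\<not> (\<exists>n. K\<^bsub>n\<^esub> (with_proj G))"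
  proof
    assume "\<exists>n. K\<^bsub>n\<^esub> (with_proj G)"
    then have K: "parcs G = {(x, y). (x, y) \<in> pverts G \<times> pverts G \<and> x \<noteq> y}"
      by (auto simp: complete_digraph_pair_def)
    obtain x y where xy: "x \<in> W" "y \<in> W" "x \<noteq> y"
      using \<open>card W \<ge> 2\<close> by (metis card_le_Suc0_iff_eq card.infinite not_numeral_le_zero
          not_less_eq_eq numeral_2_eq_2)
    then have "x \<rightarrow>\<^bsub>?D\<^esub> y"
      using K assms(4) by (force simp: arcs_ends_conv)
    then show False using sep[OF xy] D.reachable_adjI by blast
  qed
  then have "toughness G = Min {ereal (real (card S) / real (num_components_del G S)) | S.
      S \<subseteq> pverts G \<and> num_components_del G S \<ge> 2}"
    by (simp add: toughness_def)
  also have "\<dots> \<le> ereal (real (card S) / real ?c)"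
  proof (rule Min_le)
    show "finite {ereal (real (card S) / real (num_components_del G S)) | S.
        S \<subseteq> pverts G \<and> num_components_del G S \<ge> 2}"
      by (rule finite_subset[of _ "(\<lambda>S. ereal (real (card S) / real (num_components_del G S))) ` Pow (pverts G)"])
        auto
  qed (use W assms in auto)
  finally have "t \<le> real (card S) / real ?c"
    using assms(1) unfolding tough_def by (metis ereal_less_eq(3) order_trans)
  then have "t * real ?c \<le> real (card S)"
    using W assms(5) by (simp add: field_simps)
  moreover have "t * real (card W) \<le> t * real ?c"
    using W assms(2) by (intro mult_left_mono) auto
  ultimately show ?thesis by simp
qed

lemma tough_independent_set:
  assumes "tough t G" "t \<ge> 0" and I: "independent_set G I" and "card I \<ge> 2"
  shows "t * real (card I) \<le> real (card (pverts G - I))"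
proof (rule tough_card_le[OF assms(1,2)])
  have I_eq: "pverts G - (pverts G - I) = I" using I by (auto simp: independent_set_def)
  then show "I \<subseteq> pverts G - (pverts G - I)" by simp
  let ?E = "with_proj G \<restriction> (pverts G - (pverts G - I))"
  interpret E: sym_digraph ?E
    by (rule induced_graph_imp_graph) (auto intro!: induced_induce)
  have "x = y" if "x \<rightarrow>\<^sup>*\<^bsub>?E\<^esub> y" for x y
    using that
  proof (induction rule: E.reachable_induct)
    case (step y z)
    then show ?case using I I_eq by (auto simp: arcs_ends_conv independent_set_def)
  qed simp
  then show "\<not> x \<rightarrow>\<^sup>*\<^bsub>?E\<^esub> y" if "x \<noteq> y" for x y using that by blast
qed (use assms in auto)

lemma ex_maximal_independent_set:
  assumes "independent_set G J"
  obtains I where "J \<subseteq> I" "independent_set G I"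
    "\<And>y. y \<in> pverts G \<Longrightarrow> y \<notin> I \<Longrightarrow> \<exists>a\<in>I. (y, a) \<in> parcs G"
proof -
  have "finite {I. independent_set G I}"
    by (rule finite_subset[of _ "Pow (pverts G)"])
      (use pair_finite_verts in \<open>auto simp: independent_set_def\<close>)
  then obtain I where I: "independent_set G I" "J \<subseteq> I"
    and maximal: "\<And>K. independent_set G K \<Longrightarrow> I \<subseteq> K \<Longrightarrow> K = I"
    using assms finite_has_maximal2[of "{I. independent_set G I}" J] by auto
  have "\<exists>a\<in>I. (y, a) \<in> parcs G" if y: "y \<in> pverts G" "y \<notin> I" for y
  proof -
    have "\<not> independent_set G (insert y I)" using maximal[of "insert y I"] y by auto
    then show ?thesis
      using I y arcs_symmetric no_loops' unfolding independent_set_def by blast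
  qed
  with I show ?thesis using that by blast
qed

text \<open>
  An edge \<open>ab\<close> and \<open>k\<close> vertices of \<open>X\<close> would induce a copy of \<open>K\<^sub>2 \<union> kK\<^sub>1\<close>. The isomorphism \<open>g\<close> below
  sends \<open>a\<close> and \<open>b\<close> to the edge \<open>{0, 1}\<close> and numbers the chosen vertices from \<open>2\<close> on.
\<close>

lemma induced_free_card_less:
  assumes free: "induced_free (K2_union_kK1 k) G"
    and ab: "(a, b) \<in> parcs G" and X: "independent_set G X"
    and a: "\<And>x. x \<in> X \<Longrightarrow> (a, x) \<notin> parcs G" and b: "\<And>x. x \<in> X \<Longrightarrow> (b, x) \<notin> parcs G"
  shows "card X < k"
proof (rule ccontr)
  assume "\<not> card X < k"
  then obtain Y where Y: "Y \<subseteq> X" "card Y = k" "finite Y"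
    by (metis not_less obtain_subset_with_card_n)
  obtain f where f: "bij_betw f Y {2..<k + 2}"
    using Y by (metis add_diff_cancel_right' card_atLeastLessThan ex_bij_betw_finite_nat
        finite_atLeastLessThan finite_same_card_bij)
  have ba: "(b, a) \<in> parcs G" using ab arcs_symmetric by blast
  have ne: "a \<noteq> b" "a \<notin> Y" "b \<notin> Y" using ab ba a b Y no_loops' by blast+
  define g where "g x = (if x = a then 0 else if x = b then 1 else f x)" for x
  let ?H = "with_proj G \<restriction> ({a, b} \<union> Y)"
  have sub: "{a, b} \<union> Y \<subseteq> pverts G"
    using ab X Y wellformed' by (auto simp: independent_set_def)
  then have ind: "induced_subgraph ?H (with_proj G)" by (intro induced_induce) simp
  have "g ` Y = f ` Y"
    using ne by (intro image_cong) (auto simp: g_def)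
  then have gY: "g ` Y = {2..<k + 2}"
    using f by (simp add: bij_betw_def)
  have ga: "g a = 0" "g b = 1" using ne by (simp_all add: g_def)
  have "inj_on f Y" using f by (simp add: bij_betw_def)
  then have "inj_on g Y"
    using ne by (subst inj_on_cong[of Y g f]) (auto simp: g_def)
  moreover have "g a \<notin> g ` insert b Y" "g b \<notin> g ` Y" using gY ga by simp_all
  ultimately have inj: "inj_on g ({a, b} \<union> Y)"
    using ne by simp
  have "(a, a) \<notin> parcs G" "(b, b) \<notin> parcs G" using no_loops' by blast+
  moreover have "(a, y) \<notin> parcs G" "(y, a) \<notin> parcs G" "(b, y) \<notin> parcs G" "(y, b) \<notin> parcs G"
    if "y \<in> Y" for y
    using that a b Y(1) arcs_symmetric by blast+
  moreover have "(x, y) \<notin> parcs G" if "x \<in> Y" "y \<in> Y" for x y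
    using that X Y(1) unfolding independent_set_def by blast
  ultimately have arcsH: "arcs ?H = {(a, b), (b, a)}"
    using ab ba by auto
  let ?iso = "\<lparr>iso_verts = g, iso_arcs = map_prod g g, iso_head = snd, iso_tail = fst\<rparr>"
  have "pre_digraph.digraph_isomorphism ?H ?iso"
    unfolding pre_digraph.digraph_isomorphism_def
    using inj ind ga unfolding arcsH by (auto simp: inj_on_def)
  moreover have "with_proj (K2_union_kK1 k) = app_iso ?iso ?H"
  proof (rule pre_digraph.equality)
    have "{0..<k + 2} = {0, 1} \<union> {2..<k + 2}" by auto
    then show "verts (with_proj (K2_union_kK1 k)) = verts (app_iso ?iso ?H)"
      using gY ga by (simp add: K2_union_kK1_def image_Un)
    show "arcs (with_proj (K2_union_kK1 k)) = arcs (app_iso ?iso ?H)"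
      unfolding arcs_app_iso arcsH using ga by (simp add: K2_union_kK1_def)
  qed auto
  ultimately show False
    using free ind unfolding induced_free_def digraph_iso_def by blast
qed

text \<open>
  The vertex \<open>a\<close> is the other end of the edge to which the previous lemma applies; being in \<open>I\<close>, it is
  adjacent to no vertex of \<open>I\<close>, so only the non-neighbours of \<open>y\<close> count.
\<close>

lemma card_nonneighbours_less:
  assumes "induced_free (K2_union_kK1 k) G" "independent_set G I" "a \<in> I" "(y, a) \<in> parcs G"
  shows "card {b \<in> I. (y, b) \<notin> parcs G} < k"
  using assms by (intro induced_free_card_less[OF assms(1,4)]) (auto simp: independent_set_def)

lemma hamilton_pathI:
  assumes "vpath p (with_proj G)" "hd p = u" "last p = v" "set p = pverts G"
  shows "hamilton_path G u (vwalk_arcs p) v"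
proof -
  have "awalk u (vwalk_arcs p) v \<and> awalk_verts u (vwalk_arcs p) = p"
    if "vwalk p (with_proj G)" "hd p = u" "last p = v"
    using that
  proof (induction p arbitrary: u rule: induct_list012)
    case (3 x y p)
    then show ?case by (auto simp: vwalk_def awalk_Cons_iff)
  qed (auto simp: vwalk_def awalk_Nil_iff)
  then show ?thesis
    using assms by (auto simp: hamilton_path_def apath_def)
qed

end

section \<open>Longest paths\<close>

lemma vpath_with_proj_iff:
  "vpath p (with_proj G) \<longleftrightarrow>
    p \<noteq> [] \<and> distinct p \<and> set p \<subseteq> pverts G \<and> set (vwalk_arcs p) \<subseteq> parcs G"
  by (auto simp: vpath_def vwalk_def)

text \<open>
  The path \<open>P\<close> is longest among the paths with its two ends; it may be shorter than some path
  between other vertices. Every rerouting below therefore keeps both ends fixed.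
\<close>

locale longest_path = pair_graph G for G :: "'a pair_pre_digraph" +
  fixes u v :: 'a and P :: "'a list"
  assumes P: "vpath P (with_proj G)" "hd P = u" "last P = v"
    and longest: "vpath Q (with_proj G) \<Longrightarrow> hd Q = u \<Longrightarrow> last Q = v \<Longrightarrow> length Q \<le> length P"
begin

lemma distinct_P: "distinct P" and P_verts: "set P \<subseteq> pverts G"
  and P_arcs: "set (vwalk_arcs P) \<subseteq> parcs G" and P_nonempty: "P \<noteq> []"
  using P by (auto simp: vpath_with_proj_iff)

lemma no_detour:
  assumes "(x, s) \<in> set (vwalk_arcs P)" "vpath (x # q @ [s]) (with_proj G)" "set q \<inter> set P = {}"
  shows "q = []"
proof (rule ccontr)
  assume q: "q \<noteq> []"
  obtain A B where AB: "P = A @ B" "A \<noteq> []" "B \<noteq> []" "last A = x" "hd B = s"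
    using assms(1) by (rule vwalk_arcs_splitE)
  have "vpath (A @ q @ B) (with_proj G)"
    using assms P(1) AB q by (auto simp: vpath_with_proj_iff vwalk_arcs_append)
  then have "length (A @ q @ B) \<le> length P"
    using P AB by (intro longest) auto
  then show False using AB q by simp
qed

text \<open>
  Write \<open>P = A B C\<close>, where \<open>A\<close> ends in \<open>x\<close>, \<open>B\<close> runs from \<open>s\<close> to \<open>x'\<close>, and \<open>C\<close> starts with \<open>s'\<close>. Going from
  \<open>x\<close> through \<open>q\<close> to \<open>x'\<close>, back along \<open>B\<close> to \<open>s\<close>, and through \<open>r\<close> to \<open>s'\<close> keeps all vertices of \<open>P\<close> and
  adds those of \<open>q\<close>. An empty \<open>r\<close> stands for an edge between \<open>s\<close> and \<open>s'\<close>.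
\<close>

lemma no_double_detour:
  assumes arcs: "(x, s) \<in> set (vwalk_arcs P)" "(x', s') \<in> set (vwalk_arcs P)" "x \<noteq> x'"
    and q: "vpath (x # q @ [x']) (with_proj G)" "set q \<inter> set P = {}" "q \<noteq> []"
    and r: "vpath (s # r @ [s']) (with_proj G)" "set r \<inter> (set P \<union> set q) = {}"
  shows False
proof -
  have ordered: False
    if ABC: "P = A @ B @ C" "A \<noteq> []" "B \<noteq> []" "C \<noteq> []"
      and ends: "last A = x" "hd B = s" "last B = x'" "hd C = s'"
      and q: "vpath (x # q @ [x']) (with_proj G)" "set q \<inter> set P = {}" "q \<noteq> []"
      and r: "vpath (s # r @ [s']) (with_proj G)" "set r \<inter> (set P \<union> set q) = {}"
    for A B C x s x' s' q r
  proof -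
    have "vpath (A @ q @ rev B @ r @ C) (with_proj G)"
    proof (cases "r = []")
      case True
      then show ?thesis
        using q r P(1) ABC ends arcs_symmetric
        by (auto simp: vpath_with_proj_iff vwalk_arcs_append set_vwalk_arcs_rev hd_rev last_rev)
    next
      case False
      then show ?thesis
        using q r P(1) ABC ends arcs_symmetric
        by (auto simp: vpath_with_proj_iff vwalk_arcs_append set_vwalk_arcs_rev hd_rev last_rev)
    qed
    then have "length (A @ q @ rev B @ r @ C) \<le> length P"
      using P ABC by (intro longest) auto
    then show False using ABC q by simp
  qed
  have rev: "vpath (y' # rev w @ [y]) (with_proj G)" if "vpath (y # w @ [y']) (with_proj G)" for y y' w
  proof -
    have "y' # rev w @ [y] = rev (y # w @ [y'])" by simp
    then show ?thesis
      using that arcs_symmetric by (simp only: vpath_with_proj_iff set_vwalk_arcs_rev) auto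
  qed
  obtain A B C where "P = A @ B @ C" "A \<noteq> []" "B \<noteq> []" "C \<noteq> []"
    "last A = x \<and> hd B = s \<and> last B = x' \<and> hd C = s' \<or>
     last A = x' \<and> hd B = s' \<and> last B = x \<and> hd C = s"
    using vwalk_arcs_split2[OF arcs] by blast
  then show False
    using ordered[of A B C x s x' s' q r] ordered[of A B C x' s' x s "rev q" "rev r"] q r rev
    by auto
qed

lemma no_insertion:
  assumes "vpath Q (with_proj G)" "hd Q = u" "last Q = v" "length Q = length P"
    and "(y, z) \<in> set (vwalk_arcs Q)" "s \<notin> set Q" "(y, s) \<in> parcs G" "(s, z) \<in> parcs G"
  shows False
proof -
  obtain A B where AB: "Q = A @ B" "A \<noteq> []" "B \<noteq> []" "last A = y" "hd B = z"
    using assms(5) by (rule vwalk_arcs_splitE)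
  have "s \<in> pverts G" using assms(7) wellformed' by blast
  then have "vpath (A @ [s] @ B) (with_proj G)"
    using assms AB by (auto simp: vpath_with_proj_iff vwalk_arcs_append)
  then have "length (A @ [s] @ B) \<le> length P"
    using assms AB by (intro longest) auto
  then show False using AB assms(4) by simp
qed

text \<open>
  Let \<open>H\<close> be the component of \<open>h\<close> off \<open>P\<close> and \<open>C\<close> the set of its neighbours on \<open>P\<close>. Any two vertices of
  \<open>C\<close> are joined by a detour through \<open>H\<close>, so no two are consecutive; hence \<open>P\<close> leaves \<open>C\<close>
  and \<open>C\<close> separates \<open>H\<close> from another vertex. By toughness \<open>C\<close> has at least \<open>k + 1\<close> vertices and so
  at least \<open>k\<close> successors. These are independent and not adjacent to \<open>H\<close>, which leaves no room for an
  edge in \<open>H\<close>.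
\<close>

lemma outside_edge_free:
  assumes tough: "tough ((real k + 1) / 2) G" and free: "induced_free (K2_union_kK1 k) G"
    and "u \<noteq> v" and h: "h \<notin> set P" and h': "h' \<notin> set P"
  shows "(h, h') \<notin> parcs G"
proof
  assume edge: "(h, h') \<in> parcs G"
  define D where "D = with_proj G \<restriction> (pverts G - set P)"
  interpret D: sym_digraph D
    unfolding D_def by (rule induced_graph_imp_graph) (auto intro!: induced_induce)
  define H where "H = {y. h \<rightarrow>\<^sup>*\<^bsub>D\<^esub> y}"
  define C where "C = {x \<in> set P. \<exists>y\<in>H. (x, y) \<in> parcs G}"
  have Darc: "(x, y) \<in> arcs_ends D \<longleftrightarrow> (x, y) \<in> parcs G \<and> x \<notin> set P \<and> y \<notin> set P" for x y
    using wellformed' by (force simp: D_def arcs_ends_conv)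
  have HU: "y \<in> pverts G - set P" if "y \<in> H" for y
    using that D.reachable_in_verts(2)[of h y] by (simp add: H_def D_def)
  have "h \<in> verts D" using edge h wellformed' by (auto simp: D_def)
  then have hH: "h \<in> H" "h' \<in> H"
    using edge h h' Darc[of h h'] D.reachable_adjI[of h h'] D.reachable_refl by (auto simp: H_def)
  have H_step: "y' \<in> H" if "y \<in> H" "(y, y') \<in> parcs G" "y' \<notin> set P" for y y'
    using that HU[of y] Darc[of y y'] D.reachable_adj_trans[of h y y'] by (auto simp: H_def)
  have detour: "\<exists>q. q \<noteq> [] \<and> vpath (x # q @ [x']) (with_proj G) \<and> set q \<inter> set P = {}"
    if x: "x \<in> C" "x' \<in> C" "x \<noteq> x'" for x x'
  proof -
    obtain y y' where y: "y \<in> H" "(x, y) \<in> parcs G" "y' \<in> H" "(x', y') \<in> parcs G"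
      using x by (auto simp: C_def)
    have "y \<rightarrow>\<^sup>*\<^bsub>D\<^esub> h"
      using y(1) D.symmetric_reachable' by (auto simp: H_def)
    then have "y \<rightarrow>\<^sup>*\<^bsub>D\<^esub> y'"
      using y(3) D.reachable_trans by (auto simp: H_def)
    then obtain q where q: "vpath q D" "hd q = y" "last q = y'"
      by (auto simp: D.reachable_vpath_conv)
    have "q \<noteq> []" "distinct q" "set q \<subseteq> pverts G - set P" "set (vwalk_arcs q) \<subseteq> parcs G"
      using q(1) Darc by (auto simp: vpath_def vwalk_def D_def)
    then have "vpath (x # q @ [x']) (with_proj G)" "set q \<inter> set P = {}"
      using y q x P_verts arcs_symmetric
      by (auto simp: vpath_with_proj_iff vwalk_arcs_append C_def)
    then show ?thesis using \<open>q \<noteq> []\<close> by blast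
  qed
  have succ_notin: "s \<notin> C" if "x \<in> C" "(x, s) \<in> set (vwalk_arcs P)" for x s
  proof
    assume "s \<in> C"
    moreover have "x \<noteq> s" using that P_arcs no_loops' by blast
    ultimately show False using detour[of x s] no_detour[of x s] that by blast
  qed
  \<comment> \<open>A vertex of \<open>P\<close> on the other side of \<open>C\<close>: either \<open>u\<close> or the successor of \<open>u\<close>.\<close>
  obtain z where z: "z \<in> set P" "z \<notin> C"
  proof (cases "u \<in> C")
    case True
    then obtain s where "(u, s) \<in> set (vwalk_arcs P)"
      using ex_successor[of u P] \<open>u \<noteq> v\<close> P by (auto simp: C_def)
    then show ?thesis using that[of s] succ_notin True by (auto dest: vwalk_arcs_in_set)
  next
    case False
    then show ?thesis using that[of u] P P_nonempty by auto
  qed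
  have "(real k + 1) / 2 * real (card {h, z}) \<le> real (card C)"
  proof (rule tough_card_le[OF tough])
    let ?E = "with_proj G \<restriction> (pverts G - C)"
    interpret E: sym_digraph ?E
      by (rule induced_graph_imp_graph) (auto intro!: induced_induce)
    have "y \<in> H" if "h \<rightarrow>\<^sup>*\<^bsub>?E\<^esub> y" for y
      using that
    proof (induction rule: E.reachable_induct)
      case base
      then show ?case using hH by simp
    next
      case (step y y')
      have "(y, y') \<in> parcs G" "y' \<notin> C" using step(2) by (auto simp: arcs_ends_conv)
      moreover have "y' \<notin> set P"
        using calculation step arcs_symmetric by (auto simp: C_def)
      ultimately show ?case using H_step step by blast
    qed
    then have "\<not> h \<rightarrow>\<^sup>*\<^bsub>?E\<^esub> z" using HU z by blast
    moreover from this have "\<not> z \<rightarrow>\<^sup>*\<^bsub>?E\<^esub> h"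
      using E.symmetric_reachable' by blast
    ultimately show "\<not> x \<rightarrow>\<^sup>*\<^bsub>?E\<^esub> y" if "x \<in> {h, z}" "y \<in> {h, z}" "x \<noteq> y" for x y
      using that by auto
    show "C \<subseteq> pverts G" using P_verts by (auto simp: C_def)
    show "{h, z} \<subseteq> pverts G - C" using z P_verts HU hH h by (auto simp: C_def)
    show "2 \<le> card {h, z}" using z h by (cases "h = z") auto
  qed simp
  moreover have "h \<noteq> z" using z h by auto
  ultimately have C: "k + 1 \<le> card C" by simp
  define S where "S = set (vwalk_arcs P) `` C"
  have "card C - 1 \<le> card S"
    unfolding S_def by (rule card_successors[OF distinct_P]) (auto simp: C_def)
  then have "k \<le> card S" using C by simp
  moreover have "card S < k"
  proof (rule induced_free_card_less[OF free edge])
    have nonadjacent: "(a, s) \<notin> parcs G" if "s \<in> S" "a \<in> H" for a s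
    proof
      assume "(a, s) \<in> parcs G"
      then have "s \<in> C"
        using that arcs_symmetric by (auto simp: C_def S_def dest: vwalk_arcs_in_set)
      then show False using that succ_notin by (auto simp: S_def)
    qed
    then show "(h, s) \<notin> parcs G" "(h', s) \<notin> parcs G" if "s \<in> S" for s
      using nonadjacent that hH by auto
    have "(s, s') \<notin> parcs G" if sS: "s \<in> S" "s' \<in> S" for s s'
    proof
      assume ss: "(s, s') \<in> parcs G"
      obtain x x' where x: "x \<in> C" "(x, s) \<in> set (vwalk_arcs P)" "x' \<in> C" "(x', s') \<in> set (vwalk_arcs P)"
        using sS by (auto simp: S_def)
      have "x \<noteq> x'" using successor_unique[OF distinct_P] x ss no_loops' by blast
      then obtain q where "q \<noteq> []" "vpath (x # q @ [x']) (with_proj G)" "set q \<inter> set P = {}"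
        using detour x by blast
      moreover have "vpath (s # [] @ [s']) (with_proj G)"
        using ss wellformed' no_loops' by (auto simp: vpath_with_proj_iff)
      ultimately show False
        using no_double_detour[OF x(2,4) \<open>x \<noteq> x'\<close>, of q "[]"] by auto
    qed
    then show "independent_set G S"
      using P_verts by (auto simp: independent_set_def S_def dest: vwalk_arcs_in_set)
  qed
  ultimately show False by simp
qed

lemma successor_split:
  assumes "P = X @ s # D" "(s, w) \<in> set (vwalk_arcs P)"
  shows "D \<noteq> [] \<and> hd D = w"
proof -
  obtain A B where AB: "P = A @ B" "A \<noteq> []" "B \<noteq> []" "last A = s" "hd B = w"
    using assms(2) by (rule vwalk_arcs_splitE)
  then have eq: "X @ s # D = butlast A @ s # B"
    using assms(1) by (metis append.assoc append_Cons append_Nil append_butlast_last_id)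
  moreover have "s \<notin> set X" "s \<notin> set D" using assms(1) distinct_P by auto
  ultimately have "D = B"
    by (metis append_Cons_eq_iff)
  then show ?thesis using AB by simp
qed

text \<open>
  Let \<open>s\<close> be the successor of a neighbour \<open>x\<close> of \<open>h\<close>, and \<open>w\<close> the successor of \<open>s\<close>. If \<open>h\<close> is adjacent to \<open>w\<close>,
  it can take the place of \<open>s\<close>. Otherwise it suffices that \<open>w\<close> is adjacent to another successor \<open>s'\<close>
  of a neighbour \<open>x'\<close> of \<open>h\<close>: as in \<open>no_double_detour\<close>, the segment between the two cuts is
  reversed, and the edges \<open>xh\<close>, \<open>hx'\<close>, \<open>ws'\<close> replace \<open>xs\<close>, \<open>sw\<close>, \<open>x's'\<close>. All other pairs of
  consecutive vertices survive, possibly reversed; the condition on \<open>z\<close> in the conclusion protects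
  the pair \<open>y\<close>, \<open>z\<close> against being \<open>x'\<close>, \<open>s'\<close>.
\<close>

lemma exchange_successor:
  assumes h: "h \<in> pverts G" "h \<notin> set P" "(x, h) \<in> parcs G"
    and s: "(x, s) \<in> set (vwalk_arcs P)" "(s, w) \<in> set (vwalk_arcs P)" "(h, s) \<notin> parcs G"
    and w: "(h, w) \<in> parcs G \<or> (\<exists>x' s'. (x', s') \<in> set (vwalk_arcs P) \<and> s' \<noteq> s \<and>
      (x', h) \<in> parcs G \<and> (w, s') \<in> parcs G)"
  shows "\<exists>Q. vpath Q (with_proj G) \<and> hd Q = u \<and> last Q = v \<and> length Q = length P \<and> s \<notin> set Q \<and>
    (\<forall>y z. (y, z) \<in> set (vwalk_arcs P) \<and> s \<notin> {y, z} \<and>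
      (\<forall>x. (x, h) \<in> parcs G \<longrightarrow> (x, z) \<notin> set (vwalk_arcs P)) \<longrightarrow>
      (y, z) \<in> set (vwalk_arcs Q) \<or> (z, y) \<in> set (vwalk_arcs Q))"
  using w
proof (elim disjE exE conjE)
  assume hw: "(h, w) \<in> parcs G"
  obtain A B where AB: "P = A @ B" "A \<noteq> []" "B \<noteq> []" "last A = x" "hd B = s"
    using s(1) by (rule vwalk_arcs_splitE)
  then obtain D where B: "B = s # D" by (cases B) auto
  have D: "D \<noteq> []" "hd D = w" using successor_split[of A s D w] AB B s(2) by auto
  show ?thesis
    by (rule exI[of _ "A @ [h] @ D"])
      (use P AB B D h hw in \<open>auto simp: vpath_with_proj_iff vwalk_arcs_append\<close>)
next
  fix x' s' assume x': "(x', s') \<in> set (vwalk_arcs P)" "s' \<noteq> s" "(x', h) \<in> parcs G" "(w, s') \<in> parcs G"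
  have "x \<noteq> x'" using successor_unique[OF distinct_P] s(1) x' by blast
  then obtain A B C where ABC: "P = A @ B @ C" "A \<noteq> []" "B \<noteq> []" "C \<noteq> []"
    and order: "last A = x \<and> hd B = s \<and> last B = x' \<and> hd C = s' \<or>
      last A = x' \<and> hd B = s' \<and> last B = x \<and> hd C = s"
    using vwalk_arcs_split2[OF s(1) x'(1)] by blast
  have "x' \<noteq> s" using x' s(3) arcs_symmetric by blast
  from order show ?thesis
  proof
    \<comment> \<open>\<open>x\<close> comes before \<open>x'\<close>, and \<open>P = A s D C\<close>.\<close>
    assume ends: "last A = x \<and> hd B = s \<and> last B = x' \<and> hd C = s'"
    then obtain D where B: "B = s # D" using ABC by (cases B) auto
    have "D \<noteq> []" using B ends \<open>x' \<noteq> s\<close> by auto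
    then have D: "D \<noteq> []" "hd D = w" using successor_split[of A s "D @ C" w] ABC B s(2) by auto
    let ?Q = "A @ [h] @ rev D @ C"
    have arcs_P: "set (vwalk_arcs P) = set (vwalk_arcs A) \<union> {(x, s), (s, w)} \<union>
        set (vwalk_arcs D) \<union> {(x', s')} \<union> set (vwalk_arcs C)"
      using ABC B D ends by (simp add: vwalk_arcs_append) blast
    have arcs_Q: "set (vwalk_arcs ?Q) = set (vwalk_arcs A) \<union> {(x, h), (h, x')} \<union>
        {(b, a). (a, b) \<in> set (vwalk_arcs D)} \<union> {(w, s')} \<union> set (vwalk_arcs C)"
      using ABC B D ends by (simp add: vwalk_arcs_append set_vwalk_arcs_rev hd_rev last_rev) blast
    have "(h, x') \<in> parcs G" using x' arcs_symmetric by blast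
    then have "set (vwalk_arcs ?Q) \<subseteq> parcs G"
      using P_arcs h x' arcs_symmetric unfolding arcs_P arcs_Q by blast
    then have "vpath ?Q (with_proj G)"
      using h distinct_P P_verts ABC B by (auto simp: vpath_with_proj_iff)
    moreover have "hd ?Q = u \<and> last ?Q = v \<and> length ?Q = length P \<and> s \<notin> set ?Q"
      using P ABC B h distinct_P s(1) vwalk_arcs_in_set[OF s(1)] by auto
    moreover have "(y, z) \<in> set (vwalk_arcs ?Q) \<or> (z, y) \<in> set (vwalk_arcs ?Q)"
      if "(y, z) \<in> set (vwalk_arcs P)" "s \<notin> {y, z}"
        "\<forall>x. (x, h) \<in> parcs G \<longrightarrow> (x, z) \<notin> set (vwalk_arcs P)" for y z
      using that x'(1,3) unfolding arcs_P arcs_Q by blast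
    ultimately show ?thesis by blast
  next
    \<comment> \<open>\<open>x'\<close> comes before \<open>x\<close>, and \<open>P = A B s D\<close>.\<close>
    assume ends: "last A = x' \<and> hd B = s' \<and> last B = x \<and> hd C = s"
    then obtain D where C: "C = s # D" using ABC by (cases C) auto
    have D: "D \<noteq> []" "hd D = w" using successor_split[of "A @ B" s D w] ABC C s(2) by auto
    let ?Q = "A @ [h] @ rev B @ D"
    have arcs_P: "set (vwalk_arcs P) = set (vwalk_arcs A) \<union> {(x', s')} \<union>
        set (vwalk_arcs B) \<union> {(x, s), (s, w)} \<union> set (vwalk_arcs D)"
      using ABC C D ends by (simp add: vwalk_arcs_append) blast
    have arcs_Q: "set (vwalk_arcs ?Q) = set (vwalk_arcs A) \<union> {(x', h), (h, x)} \<union>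
        {(b, a). (a, b) \<in> set (vwalk_arcs B)} \<union> {(s', w)} \<union> set (vwalk_arcs D)"
      using ABC C D ends by (simp add: vwalk_arcs_append set_vwalk_arcs_rev hd_rev last_rev) blast
    have "(h, x) \<in> parcs G" "(s', w) \<in> parcs G" using h x' arcs_symmetric by blast+
    then have "set (vwalk_arcs ?Q) \<subseteq> parcs G"
      using P_arcs h x' arcs_symmetric unfolding arcs_P arcs_Q by blast
    then have "vpath ?Q (with_proj G)"
      using h distinct_P P_verts ABC C by (auto simp: vpath_with_proj_iff)
    moreover have "hd ?Q = u \<and> last ?Q = v \<and> length ?Q = length P \<and> s \<notin> set ?Q"
      using P ABC C D h distinct_P s(1) vwalk_arcs_in_set[OF s(1)] by auto
    moreover have "(y, z) \<in> set (vwalk_arcs ?Q) \<or> (z, y) \<in> set (vwalk_arcs ?Q)"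
      if "(y, z) \<in> set (vwalk_arcs P)" "s \<notin> {y, z}"
        "\<forall>x. (x, h) \<in> parcs G \<longrightarrow> (x, z) \<notin> set (vwalk_arcs P)" for y z
      using that x'(1,3) unfolding arcs_P arcs_Q by blast
    ultimately show ?thesis by blast
  qed
qed

lemma successor_not_neighbour:
  assumes h: "h \<in> pverts G" "h \<notin> set P" "(h, x) \<in> parcs G" and s: "(x, s) \<in> set (vwalk_arcs P)"
  shows "(h, s) \<notin> parcs G"
proof
  assume hs: "(h, s) \<in> parcs G"
  have "x \<noteq> s" using s P_arcs no_loops' by blast
  then have "vpath (x # [h] @ [s]) (with_proj G)"
    using hs h s wellformed' no_loops' arcs_symmetric vwalk_arcs_in_set[OF s]
    by (auto simp: vpath_with_proj_iff)
  then show False using no_detour[OF s, of "[h]"] h by simp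
qed

lemma successors_not_linked:
  assumes h: "h \<in> pverts G" "h \<notin> set P" and x: "(h, x) \<in> parcs G" "(h, x') \<in> parcs G"
    and s: "(x, s) \<in> set (vwalk_arcs P)" "(x', s') \<in> set (vwalk_arcs P)"
    and r: "set r \<inter> (set P \<union> {h}) = {}"
  shows "\<not> vpath (s # r @ [s']) (with_proj G)"
proof
  assume path: "vpath (s # r @ [s']) (with_proj G)"
  have "x \<noteq> x'" using successor_unique[OF distinct_P] s path by (auto simp: vpath_with_proj_iff)
  then have "vpath (x # [h] @ [x']) (with_proj G)"
    using x h s wellformed' no_loops' arcs_symmetric vwalk_arcs_in_set[OF s(1)] vwalk_arcs_in_set[OF s(2)]
    by (auto simp: vpath_with_proj_iff)
  then show False
    using no_double_detour[OF s \<open>x \<noteq> x'\<close>, of "[h]" r] path h r by auto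
qed

text \<open>
  Two successors are non-adjacent by rerouting through \<open>h\<close>. If \<open>s \<in> S\<close> were adjacent to some \<open>w\<close> off \<open>P\<close>,
  then \<open>w\<close> would be adjacent to no further successor \<open>s'\<close>, again by rerouting, now through both
  \<open>h\<close> and \<open>w\<close>. The edge \<open>sw\<close> and the other successors would then contain a forbidden subgraph, as
  there are at least \<open>2k - 2 \<ge> k\<close> of them.
\<close>

lemma successors_outside_independent:
  assumes "k \<ge> 2" and free: "induced_free (K2_union_kK1 k) G"
    and h: "h \<in> pverts G" "h \<notin> set P"
    and S_def: "S = set (vwalk_arcs P) `` {x. (h, x) \<in> parcs G}" and cardS: "2 * k - 1 \<le> card S"
    and outside: "\<And>a b. a \<notin> set P \<Longrightarrow> b \<notin> set P \<Longrightarrow> (a, b) \<notin> parcs G"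
  shows "independent_set G (S \<union> (pverts G - set P))"
proof -
  have SP: "S \<subseteq> set P" by (auto simp: S_def dest: vwalk_arcs_in_set)
  have finS: "finite S" using SP finite_subset by auto
  have no_link: "\<not> vpath (s # r @ [s']) (with_proj G)"
    if "s \<in> S" "s' \<in> S" "set r \<inter> (set P \<union> {h}) = {}" for s s' r
    using that successors_not_linked[OF h] unfolding S_def by blast
  have SS: "(s, s') \<notin> parcs G" if "s \<in> S" "s' \<in> S" for s s'
  proof
    assume "(s, s') \<in> parcs G"
    then have "vpath (s # [] @ [s']) (with_proj G)"
      using wellformed' no_loops' by (auto simp: vpath_with_proj_iff)
    then show False using no_link[OF that, of "[]"] by simp
  qed
  have SO: "(s, w) \<notin> parcs G" if s: "s \<in> S" and w: "w \<notin> set P" for s w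
  proof
    assume sw: "(s, w) \<in> parcs G"
    have "(h, s) \<notin> parcs G" using s successor_not_neighbour[OF h] unfolding S_def by blast
    then have "w \<noteq> h" using sw arcs_symmetric by blast
    have "card (S - {s}) < k"
    proof (rule induced_free_card_less[OF free sw])
      show "independent_set G (S - {s})"
        using SP P_verts SS unfolding independent_set_def by blast
      show "(w, s') \<notin> parcs G" if "s' \<in> S - {s}" for s'
      proof
        assume "(w, s') \<in> parcs G"
        then have "vpath (s # [w] @ [s']) (with_proj G)"
          using sw that s w SP wellformed' no_loops' by (auto simp: vpath_with_proj_iff)
        then show False using no_link[of s s' "[w]"] that s w \<open>w \<noteq> h\<close> by simp
      qed
    qed (use SS s in auto)
    moreover have "card S - 1 = card (S - {s})" using s finS by simp
    ultimately show False using cardS \<open>k \<ge> 2\<close> by linarith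
  qed
  show ?thesis
    using SS SO outside SP P_verts arcs_symmetric unfolding independent_set_def by blast
qed

text \<open>
  Otherwise \<open>P\<close> has at most one vertex more outside \<open>I\<close> than inside. As \<open>I\<close> also contains \<open>h\<close>, which
  is off \<open>P\<close>, at most \<open>card I\<close> vertices of the graph are outside \<open>I\<close>, and deleting them leaves
  \<open>card I\<close> components.
\<close>

lemma ex_consecutive_outside_independent_set:
  assumes tough: "tough t G" "t > 1" and I: "independent_set G I" "pverts G - set P \<subseteq> I"
    and h: "h \<in> I" "h \<notin> set P" and "card I \<ge> 2"
  shows "\<exists>y z. (y, z) \<in> set (vwalk_arcs P) \<and> y \<notin> I \<and> z \<notin> I"
proof (rule ccontr)
  assume "\<not> ?thesis"
  then have "length (filter (\<lambda>x. x \<notin> I) P) \<le> length (filter (\<lambda>x. x \<in> I) P) + 1"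
    by (intro alternating_list_bound) blast
  moreover have "set P - I = set (filter (\<lambda>x. x \<notin> I) P)" "set P \<inter> I = set (filter (\<lambda>x. x \<in> I) P)"
    by auto
  ultimately have "card (set P - I) \<le> card (set P \<inter> I) + 1"
    using distinct_P distinct_card distinct_filter by metis
  moreover have "set P \<inter> I \<subset> I" using h by auto
  moreover have "finite I"
    using I(1) finite_subset[OF _ pair_finite_verts] unfolding independent_set_def by blast
  ultimately have "card (set P - I) \<le> card I"
    using psubset_card_mono[of I "set P \<inter> I"] by linarith
  moreover have "pverts G - I = set P - I" using P_verts I by auto
  ultimately have "t * real (card I) \<le> 1 * real (card I)"
    using tough_independent_set[OF tough(1) _ I(1) \<open>card I \<ge> 2\<close>] tough(2) by simp
  then show False using \<open>card I \<ge> 2\<close> tough(2) by (simp add: mult_le_cancel_right)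
qed

lemma longest_path_spanning:
  assumes "k \<ge> 2" "u \<noteq> v"
    and tough: "tough ((real k + 1) / 2) G" and free: "induced_free (K2_union_kK1 k) G"
    and degree: "\<And>x. x \<in> pverts G \<Longrightarrow> 2 * k \<le> card {y. (x, y) \<in> parcs G}"
  shows "set P = pverts G"
proof (rule ccontr)
  assume "set P \<noteq> pverts G"
  then obtain h where h: "h \<in> pverts G" "h \<notin> set P" using P_verts by blast
  have outside: "(a, b) \<notin> parcs G" if "a \<notin> set P" "b \<notin> set P" for a b
    using outside_edge_free[OF tough free \<open>u \<noteq> v\<close>] that by blast
  define N where "N = {x. (h, x) \<in> parcs G}"
  define S where "S = set (vwalk_arcs P) `` N"
  have NP: "N \<subseteq> set P" using outside h by (auto simp: N_def)
  have cardS: "2 * k - 1 \<le> card S"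
    using card_successors[OF distinct_P NP] degree[OF h(1)] unfolding N_def S_def by linarith
  have SP: "S \<subseteq> set P" by (auto simp: S_def dest: vwalk_arcs_in_set)
  have finS: "finite S" using SP finite_subset by auto
  have hS: "(h, s) \<notin> parcs G" if "s \<in> S" for s
    using that successor_not_neighbour[OF h] by (auto simp: S_def N_def)
  obtain I where I: "S \<union> (pverts G - set P) \<subseteq> I" "independent_set G I"
    and maximal: "\<And>y. y \<in> pverts G \<Longrightarrow> y \<notin> I \<Longrightarrow> \<exists>a\<in>I. (y, a) \<in> parcs G"
    using ex_maximal_independent_set successors_outside_independent[OF \<open>k \<ge> 2\<close> free h] outside
      cardS unfolding S_def N_def by metis
  have finI: "finite I"
    using I(2) finite_subset[OF _ pair_finite_verts] unfolding independent_set_def by blast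
  define T where "T = insert h S"
  have T: "T \<subseteq> I" "2 * k \<le> card T" "finite T"
    using I cardS SP h finS \<open>k \<ge> 2\<close> by (auto simp: T_def card_insert_if)
  have misses_T: "card {b \<in> T. (y, b) \<notin> parcs G} < k" if y: "y \<in> pverts G" "y \<notin> I" for y
  proof -
    have "card {b \<in> T. (y, b) \<notin> parcs G} \<le> card {b \<in> I. (y, b) \<notin> parcs G}"
      using T finI by (intro card_mono) auto
    also have "\<dots> < k" using maximal[OF y] card_nonneighbours_less[OF free I(2)] by blast
    finally show ?thesis .
  qed
  have "card T \<le> card I" using T finI by (simp add: card_mono)
  then have "\<exists>y z. (y, z) \<in> set (vwalk_arcs P) \<and> y \<notin> I \<and> z \<notin> I"
    using T I h \<open>k \<ge> 2\<close>
    by (intro ex_consecutive_outside_independent_set[OF tough _ I(2) _ _ h(2)]) (auto simp: T_def)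
  then obtain y z where yz: "(y, z) \<in> set (vwalk_arcs P)" "y \<notin> I" "z \<notin> I" by blast
  have yzV: "y \<in> pverts G" "z \<in> pverts G" using yz P_verts by (auto dest: vwalk_arcs_in_set)
  define M where "M = {b \<in> T. (y, b) \<in> parcs G \<and> (z, b) \<in> parcs G}"
  have "T = M \<union> ({b \<in> T. (y, b) \<notin> parcs G} \<union> {b \<in> T. (z, b) \<notin> parcs G})" by (auto simp: M_def)
  then have "card T \<le> card M + (card {b \<in> T. (y, b) \<notin> parcs G} + card {b \<in> T. (z, b) \<notin> parcs G})"
    by (metis (no_types, lifting) card_Un_le order_trans add_left_mono)
  then have "2 \<le> card M" using T misses_T[OF yzV(1) yz(2)] misses_T[OF yzV(2) yz(3)] by linarith
  have "h \<notin> M"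
  proof
    assume "h \<in> M"
    then have "z \<in> S" "(h, z) \<in> parcs G"
      using yz arcs_symmetric by (auto simp: M_def S_def N_def)
    then show False using hS by blast
  qed
  \<comment> \<open>Having two choices in \<open>M\<close> allows avoiding \<open>v\<close>, so that \<open>s\<close> has a successor \<open>w\<close>.\<close>
  have "\<not> M \<subseteq> {v}"
    using \<open>2 \<le> card M\<close> card_mono[of "{v}" M] by auto
  then obtain s where s: "s \<in> S" "s \<noteq> v" "(y, s) \<in> parcs G" "(s, z) \<in> parcs G"
    using \<open>h \<notin> M\<close> arcs_symmetric by (auto simp: M_def T_def)
  obtain x where x: "(x, h) \<in> parcs G" "(x, s) \<in> set (vwalk_arcs P)"
    using s(1) arcs_symmetric by (auto simp: S_def N_def)
  obtain w where w: "(s, w) \<in> set (vwalk_arcs P)"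
    using ex_successor[of s P] s SP P by auto
  have sI: "s \<in> I" using s T by (auto simp: T_def)
  have wI: "w \<notin> I" "w \<in> pverts G" "(w, s) \<in> parcs G"
    using I sI w P_arcs wellformed' arcs_symmetric by (auto simp: independent_set_def)
  have alternative: "(h, w) \<in> parcs G \<or> (\<exists>x' s'. (x', s') \<in> set (vwalk_arcs P) \<and> s' \<noteq> s \<and>
      (x', h) \<in> parcs G \<and> (w, s') \<in> parcs G)"
  proof (cases "(h, w) \<in> parcs G")
    case False
    \<comment> \<open>As \<open>w\<close> is outside \<open>I\<close> and misses \<open>h\<close>, it misses at most \<open>k - 2\<close> of the \<open>2k - 2\<close> or more others.\<close>
    have "\<not> T - {h, s} \<subseteq> {b \<in> T. (w, b) \<notin> parcs G} - {h}"
    proof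
      assume "T - {h, s} \<subseteq> {b \<in> T. (w, b) \<notin> parcs G} - {h}"
      then have "T \<subseteq> insert s {b \<in> T. (w, b) \<notin> parcs G}"
        using False arcs_symmetric by auto
      then have "card T \<le> card (insert s {b \<in> T. (w, b) \<notin> parcs G})"
        using T by (intro card_mono) auto
      also have "\<dots> \<le> Suc (card {b \<in> T. (w, b) \<notin> parcs G})"
        using T by (simp add: card_insert_if)
      finally show False using T misses_T[OF wI(2,1)] \<open>k \<ge> 2\<close> by linarith
    qed
    then obtain s' where s': "s' \<in> S" "s' \<noteq> s" "(w, s') \<in> parcs G" by (auto simp: T_def)
    then obtain x' where "(h, x') \<in> parcs G" "(x', s') \<in> set (vwalk_arcs P)"
      by (auto simp: S_def N_def)
    then show ?thesis using s' arcs_symmetric by blast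
  qed simp
  obtain Q where Q: "vpath Q (with_proj G)" "hd Q = u" "last Q = v" "length Q = length P" "s \<notin> set Q"
    and keep: "\<And>y z. (y, z) \<in> set (vwalk_arcs P) \<Longrightarrow> s \<notin> {y, z} \<Longrightarrow>
      (\<And>x. (x, h) \<in> parcs G \<Longrightarrow> (x, z) \<notin> set (vwalk_arcs P)) \<Longrightarrow>
      (y, z) \<in> set (vwalk_arcs Q) \<or> (z, y) \<in> set (vwalk_arcs Q)"
    using exchange_successor[OF h x w _ alternative] hS[OF s(1)] by blast
  have "(y, z) \<in> set (vwalk_arcs Q) \<or> (z, y) \<in> set (vwalk_arcs Q)"
  proof (rule keep[OF yz(1)])
    show "s \<notin> {y, z}" using yz sI by auto
    show "(x, z) \<notin> set (vwalk_arcs P)" if "(x, h) \<in> parcs G" for x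
      using that yz T arcs_symmetric by (auto simp: T_def S_def N_def)
  qed
  then show False
    using no_insertion[OF Q(1-4) _ Q(5)] s arcs_symmetric by blast
qed

end

theorem corollary1p10:
  fixes G :: "'a pair_pre_digraph" and k :: nat
  assumes "pair_graph G"
    and "k \<ge> 2"
    and "tough ((real k + 1) / 2) G"
    and "induced_free (K2_union_kK1 k) G"
    and "min_degree G \<ge> 2 * k"
  shows "hamilton_connected G"
  unfolding hamilton_connected_def
proof (intro ballI impI)
  interpret pair_graph G by fact
  fix u v assume uv: "u \<in> pverts G" "v \<in> pverts G" "u \<noteq> v"
  have "u \<rightarrow>\<^sup>*\<^bsub>with_proj G\<^esub> v"
  proof (rule ccontr)
    assume unreachable: "\<not> ?thesis"
    \<comment> \<open>Positive toughness implies connectedness: delete the empty set.\<close>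
    have "(real k + 1) / 2 * real (card {u, v}) \<le> real (card ({} :: 'a set))"
    proof (rule tough_card_le[OF assms(3)])
      show "\<not> x \<rightarrow>\<^sup>*\<^bsub>with_proj G \<restriction> (pverts G - {})\<^esub> y" if "x \<in> {u, v}" "y \<in> {u, v}" "x \<noteq> y" for x y
        using that unreachable reachable_induce_subgraphD
          symmetric_reachable' by auto
    qed (use uv in auto)
    then show False using uv by simp
  qed
  then have paths: "{p. vpath p (with_proj G) \<and> hd p = u \<and> last p = v} \<noteq> {}" (is "?paths \<noteq> {}")
    by (auto simp: reachable_vpath_conv)
  have finite_paths: "finite ?paths" by (rule finite_subset[OF _ vpaths_finite]) auto
  have "Max (length ` ?paths) \<in> length ` ?paths"
    using paths finite_paths by (intro Max_in) auto
  then obtain P where P: "vpath P (with_proj G)" "hd P = u" "last P = v"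
    "length P = Max (length ` ?paths)" by auto
  have "length Q \<le> length P" if "vpath Q (with_proj G)" "hd Q = u" "last Q = v" for Q
    using that finite_paths P(4) by (auto intro: Max_ge)
  then interpret longest_path G u v P
    using P(1-3) by unfold_locales
  have "2 * k \<le> card {y. (x, y) \<in> parcs G}" if "x \<in> pverts G" for x
  proof -
    have "2 * k \<le> out_degree G x"
      using assms(5) that pair_finite_verts unfolding min_degree_def
      by (meson Min_le finite_imageI image_eqI order_trans)
    also have "\<dots> = card {y. (x, y) \<in> parcs G}"
      unfolding out_degree_def out_arcs_def
      by (rule bij_betw_same_card[of snd]) (auto simp: bij_betw_def inj_on_def image_def)
    finally show ?thesis .
  qed
  then have "set P = pverts G"
    using longest_path_spanning assms uv by blast
  then have "hamilton_path G u (vwalk_arcs P) v"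
    using P by (intro hamilton_pathI)
  then show "\<exists>p. hamilton_path G u p v" ..
qed

end
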